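(* A metric space $X$ is homogeneous isosceles-free if and only if it is uniquely $2$-homogeneous.
   Context: An isometry is a bijective distance-preserving map; $\operatorname{Aut}(X)$ is the group of all isometries $X\to X$. For $n\in\{1,2,3,\dots\}$, a metric space $X$ is $n$-homogeneous if every isometry $f\colon A\to B$ between subspaces $A,B\subseteq X$ with $|A|\le n$ extends to some $F\in\operatorname{Aut}(X)$ (i.e. $F|_A=f$). $X$ is uniquely $n$-homogeneous if for every isometry $f\colon A\to B$ between subspaces $A,B\subseteq X$ with $0<|A|\le n$ there exists a unique $F\in\operatorname{Aut}(X)$ with $F|_A=f$. A metric space $X$ is isosceles-free if $d(x,y)\neq d(x,z)$ for all pairwise distinct $x,y,z\in X$. A homogeneous isosceles-free space is a metric space that is both $1$-homogeneous and isosceles-free. *)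

theory Defs
  imports "HOL-Analysis.Abstract_Metric_Spaces"
begin

context Metric_space
begin

definition isometry_between :: "'a set \<Rightarrow> 'a set \<Rightarrow> ('a \<Rightarrow> 'a) \<Rightarrow> bool" where
  "isometry_between A B f \<longleftrightarrow>
     bij_betw f A B \<and> (\<forall>x\<in>A. \<forall>y\<in>A. d (f x) (f y) = d x y)"

text \<open>
  Self-isometries are required to be extensional (with the fixed value \<open>undefined\<close> outside
  \<open>M\<close>), so that equality in \<open>Aut\<close> is equality of maps \<open>M \<rightarrow> M\<close>; the uniqueness
  in \<open>uniquely_homogeneous\<close> relies on this.
\<close>

definition Aut :: "('a \<Rightarrow> 'a) set" where
  "Aut = {F \<in> extensional M. isometry_between M M F}"

text \<open>
  \<open>finite A\<close> is stated separately because \<open>card\<close> of an infinite set is \<open>0\<close>. In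
  \<open>n_homogeneous\<close> the set \<open>A\<close> may be empty.
\<close>

definition n_homogeneous :: "nat \<Rightarrow> bool" where
  "n_homogeneous n \<longleftrightarrow>
     (\<forall>A B f. A \<subseteq> M \<longrightarrow> B \<subseteq> M \<longrightarrow> finite A \<longrightarrow> card A \<le> n \<longrightarrow> isometry_between A B f \<longrightarrow>
        (\<exists>F\<in>Aut. \<forall>x\<in>A. F x = f x))"

definition uniquely_homogeneous :: "nat \<Rightarrow> bool" where
  "uniquely_homogeneous n \<longleftrightarrow>
     (\<forall>A B f. A \<subseteq> M \<longrightarrow> B \<subseteq> M \<longrightarrow> finite A \<longrightarrow> 0 < card A \<longrightarrow> card A \<le> n \<longrightarrow>
        isometry_between A B f \<longrightarrow> (\<exists>!F. F \<in> Aut \<and> (\<forall>x\<in>A. F x = f x)))"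

definition isosceles_free :: bool where
  "isosceles_free \<longleftrightarrow>
     (\<forall>x\<in>M. \<forall>y\<in>M. \<forall>z\<in>M. x \<noteq> y \<longrightarrow> x \<noteq> z \<longrightarrow> y \<noteq> z \<longrightarrow> d x y \<noteq> d x z)"

definition homogeneous_isosceles_free :: bool where
  "homogeneous_isosceles_free \<longleftrightarrow> n_homogeneous 1 \<and> isosceles_free"

end

end

theory Submission
  imports Defs
begin

text \<open>
  In an isosceles-free space a point is determined by its distance to any one given point \<open>p\<close>,
  as two different points at the same distance from \<open>p\<close> would span an isosceles triangle with
  apex \<open>p\<close>. Hence a distance-preserving map is determined by its value at a single point
  (\<open>isometries_agreeing_at_point\<close>). Therefore an automorphism that extends the restriction of
  \<open>f\<close> to one point automatically extends \<open>f\<close>, and it is the only one; this gives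
  unique homogeneity for nonempty domains of every finite size.

  Conversely, an isosceles triangle with apex \<open>x\<close> and base \<open>y\<close>, \<open>z\<close> yields an isometry
  of two-point spaces that fixes \<open>x\<close> and sends \<open>y\<close> to \<open>z\<close>. Its extension and the identity
  are two different automorphisms that extend the identity of \<open>{x}\<close>.
\<close>

context Metric_space
begin

lemma isometry_betweenD:
  assumes "isometry_between A B f"
  shows "x \<in> A \<Longrightarrow> f x \<in> B"
    and "x \<in> A \<Longrightarrow> y \<in> A \<Longrightarrow> d (f x) (f y) = d x y"
  using assms unfolding isometry_between_def bij_betw_def by auto

lemma n_homogeneousD:
  assumes "n_homogeneous n" "A \<subseteq> M" "B \<subseteq> M" "finite A" "card A \<le> n" "isometry_between A B f"
  shows "\<exists>F\<in>Aut. \<forall>x\<in>A. F x = f x"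
  using assms(1)[unfolded n_homogeneous_def, rule_format, OF assms(2-6)] .

lemma uniquely_homogeneousD:
  assumes "uniquely_homogeneous n" "A \<subseteq> M" "B \<subseteq> M" "finite A" "0 < card A" "card A \<le> n"
    and "isometry_between A B f"
  shows "\<exists>!F. F \<in> Aut \<and> (\<forall>x\<in>A. F x = f x)"
  using assms(1)[unfolded uniquely_homogeneous_def, rule_format, OF assms(2-7)] .

lemma isosceles_free_determined_by_distance:
  assumes "isosceles_free" "p \<in> M" "x \<in> M" "y \<in> M" "d p x = d p y"
  shows "x = y"
  \<comment> \<open>If one of the points is \<open>p\<close> itself, then the common distance is zero.\<close>
  using assms unfolding isosceles_free_def by (metis zero)

text \<open>
  Both \<open>f x\<close> and \<open>g x\<close> lie at distance \<open>d a x\<close> from the common value \<open>f a = g a\<close>. The domains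
  differ so that a map on a subspace can be compared with an automorphism.
\<close>

lemma isometries_agreeing_at_point:
  assumes "isosceles_free" "A \<subseteq> C" "B \<subseteq> M" "D \<subseteq> M"
    and f: "isometry_between A B f" and g: "isometry_between C D g"
    and "a \<in> A" "f a = g a" "x \<in> A"
  shows "f x = g x"
proof (rule isosceles_free_determined_by_distance)
  have "a \<in> C" "x \<in> C"
    using assms by auto
  then have "d (f a) (f x) = d a x" "d (g a) (g x) = d a x"
    using isometry_betweenD(2)[OF f] isometry_betweenD(2)[OF g] \<open>a \<in> A\<close> \<open>x \<in> A\<close> by auto
  then show "d (f a) (f x) = d (f a) (g x)"
    using \<open>f a = g a\<close> by simp
  show "f a \<in> M" "f x \<in> M" "g x \<in> M"
    using isometry_betweenD(1)[OF f] isometry_betweenD(1)[OF g] assms(2-4) \<open>a \<in> A\<close> \<open>x \<in> A\<close>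
    by blast+
qed fact

lemma isometry_between_singleton:
  assumes "isometry_between A B f" "a \<in> A"
  shows "isometry_between {a} {f a} f"
  using assms unfolding isometry_between_def by simp

lemma id_in_Aut: "restrict id M \<in> Aut"
  unfolding Aut_def isometry_between_def bij_betw_def inj_on_def by auto

lemma Aut_eqI:
  assumes "isosceles_free" "F \<in> Aut" "G \<in> Aut" "a \<in> M" "F a = G a"
  shows "F = G"
proof (rule extensionalityI)
  show "F \<in> extensional M" "G \<in> extensional M"
    using assms unfolding Aut_def by auto
  show "F x = G x" if "x \<in> M" for x
    using isometries_agreeing_at_point[of M M M M F G a x] assms that
    unfolding Aut_def by auto
qed

lemma homogeneous_isosceles_free_imp_uniquely_homogeneous:
  assumes "homogeneous_isosceles_free"
  shows "uniquely_homogeneous n"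
  unfolding uniquely_homogeneous_def
proof (intro allI impI)
  fix A B f
  assume "A \<subseteq> M" "B \<subseteq> M" "0 < card A" and f: "isometry_between A B f"
  have free: "isosceles_free" and hom: "n_homogeneous 1"
    using assms unfolding homogeneous_isosceles_free_def by auto
  obtain a where a: "a \<in> A"
    using \<open>0 < card A\<close> by fastforce
  have "{a} \<subseteq> M" "{f a} \<subseteq> M"
    using a \<open>A \<subseteq> M\<close> \<open>B \<subseteq> M\<close> isometry_betweenD(1)[OF f] by auto
  then have "\<exists>F\<in>Aut. \<forall>x\<in>{a}. F x = f x"
    by (intro n_homogeneousD[OF hom _ _ _ _ isometry_between_singleton[OF f a]]) simp_all
  then obtain F where F: "F \<in> Aut" "F a = f a"
    by auto
  have "isometry_between M M F"
    using F(1) unfolding Aut_def by simp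
  then have "\<forall>x\<in>A. F x = f x"
    using isometries_agreeing_at_point[OF free \<open>A \<subseteq> M\<close> \<open>B \<subseteq> M\<close> order_refl f, of F] a F(2)
    by simp
  with \<open>F \<in> Aut\<close> show "\<exists>!F. F \<in> Aut \<and> (\<forall>x\<in>A. F x = f x)"
  proof (intro ex1I conjI)
    fix G
    assume G: "G \<in> Aut \<and> (\<forall>x\<in>A. G x = f x)"
    then have "G a = F a"
      using a F(2) by simp
    then show "G = F"
      using Aut_eqI[OF free, of G F a] G F(1) a \<open>A \<subseteq> M\<close> by blast
  qed
qed

text \<open>
  Only the empty isometry is not covered by unique homogeneity; the identity extends it.
\<close>

lemma uniquely_homogeneous_imp_n_homogeneous:
  assumes "uniquely_homogeneous n"
  shows "n_homogeneous n"
  unfolding n_homogeneous_def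
proof (intro allI impI)
  fix A B f
  assume *: "A \<subseteq> M" "B \<subseteq> M" "finite A" "card A \<le> n" "isometry_between A B f"
  show "\<exists>F\<in>Aut. \<forall>x\<in>A. F x = f x"
  proof (cases "A = {}")
    case True
    then show ?thesis using id_in_Aut by auto
  next
    case False
    then have "0 < card A" using * by (simp add: card_gt_0_iff)
    then show ?thesis
      using ex1_implies_ex[OF uniquely_homogeneousD[OF assms *(1-3) _ *(4,5)]] by (simp add: Bex_def)
  qed
qed

lemma n_homogeneous_mono:
  assumes "n_homogeneous n" "m \<le> n"
  shows "n_homogeneous m"
  unfolding n_homogeneous_def
proof (intro allI impI)
  fix A B f
  assume "A \<subseteq> M" "B \<subseteq> M" "finite A" "card A \<le> m" "isometry_between A B f"
  then show "\<exists>F\<in>Aut. \<forall>x\<in>A. F x = f x"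
    using assms(2) by (intro n_homogeneousD[OF assms(1)]) simp_all
qed

text \<open>
  Both \<open>F\<close> and the identity extend the identity of \<open>{x}\<close>, so they coincide.
\<close>

lemma uniquely_homogeneous_point_stabilizer:
  assumes "uniquely_homogeneous n" "1 \<le> n" "F \<in> Aut" "x \<in> M" "F x = x" "y \<in> M"
  shows "F y = y"
proof -
  have "isometry_between {x} {x} id"
    unfolding isometry_between_def by simp
  then have unique: "\<exists>!G. G \<in> Aut \<and> (\<forall>u\<in>{x}. G u = id u)"
    using assms(2,4) by (intro uniquely_homogeneousD[OF assms(1), of "{x}" "{x}" id]) simp_all
  have "F = restrict id M"
    using the1_equality[OF unique, of F] the1_equality[OF unique, of "restrict id M"]
      assms(3-5) id_in_Aut by simp
  then show ?thesis
    using \<open>y \<in> M\<close> by simp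
qed

lemma uniquely_homogeneous_imp_isosceles_free:
  assumes "uniquely_homogeneous n" "2 \<le> n"
  shows "isosceles_free"
  unfolding isosceles_free_def
proof (intro ballI impI notI)
  fix x y z
  assume M: "x \<in> M" "y \<in> M" "z \<in> M" and ne: "x \<noteq> y" "x \<noteq> z" "y \<noteq> z"
    and eq: "d x y = d x z"
  let ?f = "id(y := z)"
  have "isometry_between {x, y} {x, z} ?f"
    using M ne eq unfolding isometry_between_def bij_betw_def inj_on_def
    by (auto simp: commute)
  moreover have "card {x, y} \<le> n" "finite {x, y}" "{x, y} \<subseteq> M" "{x, z} \<subseteq> M"
    using ne M \<open>2 \<le> n\<close> by simp_all
  ultimately have "\<exists>F\<in>Aut. \<forall>u\<in>{x, y}. F u = ?f u"
    by (intro n_homogeneousD[OF uniquely_homogeneous_imp_n_homogeneous[OF assms(1)],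
          of "{x, y}" "{x, z}" ?f])
  then obtain F where F: "F \<in> Aut" "\<forall>u\<in>{x, y}. F u = ?f u"
    by (rule bexE)
  then have Fx: "F x = x" and "F y = z"
    using ne by auto
  moreover have "F y = y"
    using uniquely_homogeneous_point_stabilizer[OF assms(1) _ \<open>F \<in> Aut\<close> _ Fx] M \<open>2 \<le> n\<close>
    by simp
  ultimately show False
    using \<open>y \<noteq> z\<close> by simp
qed

end

theorem proposition3p6:
  fixes M :: "'a set" and d :: "'a \<Rightarrow> 'a \<Rightarrow> real"
  assumes "Metric_space M d"
  shows "Metric_space.homogeneous_isosceles_free M d \<longleftrightarrow>
         Metric_space.uniquely_homogeneous M d 2"
proof -
  interpret Metric_space M d by fact
  show ?thesis
  proof
    assume "uniquely_homogeneous 2"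
    then show "homogeneous_isosceles_free"
      unfolding homogeneous_isosceles_free_def
      using uniquely_homogeneous_imp_n_homogeneous n_homogeneous_mono[of 2 1]
        uniquely_homogeneous_imp_isosceles_free by auto
  qed (rule homogeneous_isosceles_free_imp_uniquely_homogeneous)
qed

end
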